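(* Let $G$ be a finite simple graph with edge weight function $w$ and vertex weight function $w_1$, and let $\theta$ be a real number. Let $u$ be a $(\theta,w,w_1)$-special vertex of $G$. Then for every vertex $v$ of $G\setminus u$, $v$ is $(\theta,w,w_1)$-essential in $G\setminus u$ if and only if $v$ is $(\theta,w,w_1)$-essential in $G$.
   Context: An edge weight function $w$ assigns a nonzero complex number $w(e)$ to each edge $e$; a vertex weight function $w_1$ assigns a real number $w_1(u)$ (possibly $0$) to each vertex $u$. Subgraphs (obtained by deleting vertices or edges) carry the restricted weights. $G\setminus u$ denotes $G$ with the vertex $u$ and its incident edges deleted. For $A\subseteq E(G)$ put $w(A)=\prod_{e\in A}w(e)$. The edge weighted matching polynomial is $\mu_w(G,x)=\sum_{M}(-1)^{|M|}|w(M)|^2x^{n-2|M|}$, summed over all matchings $M$ of $G$ (including the empty matching), $n=|V(G)|$. The weighted matching polynomial is $\eta_{(w,w_1)}(G,x)=\sum_{S\subseteq V(G)}(-1)^{|V(G)\setminus S|}\big(\prod_{u\in V(G)\setminus S}w_1(u)\big)\mu_w(G[S],x)$, where $G[S]$ is the induced subgraph on $S$, $\mu_w$ of the empty graph is $1$, and $\eta_{(w,w_1)}$ of the empty graph is $1$. Write $\mathrm{mult}(\theta,H)$ for the multiplicity of $\theta$ as a root of $\eta_{(w,w_1)}(H,x)$ ($0$ if not a root). A vertex $u$ of $H$ is $(\theta,w,w_1)$-essential if $\mathrm{mult}(\theta,H\setminus u)=\mathrm{mult}(\theta,H)-1$, $(\theta,w,w_1)$-neutral if $\mathrm{mult}(\theta,H\setminus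 u)=\mathrm{mult}(\theta,H)$, $(\theta,w,w_1)$-positive if $\mathrm{mult}(\theta,H\setminus u)=\mathrm{mult}(\theta,H)+1$; $u$ is $(\theta,w,w_1)$-special if it is not $(\theta,w,w_1)$-essential but is adjacent to some $(\theta,w,w_1)$-essential vertex of $H$. *)

theory Defs
  imports Complex_Main "HOL-Computational_Algebra.Polynomial"
begin

text \<open>A finite simple graph is given by a finite vertex set V and a symmetric,
irreflexive edge relation E (edges only between vertices of V).  Subgraphs induced
on S \<subseteq> V are obtained by keeping E and restricting the vertex set to S.
Edges are represented as two-element sets.  The edge weight function w assigns a
complex number to each edge (a two-element set); the vertex weight w1 is real.\<close>

definition edges :: "'a set \<Rightarrow> ('a \<Rightarrow> 'a \<Rightarrow> bool) \<Rightarrow> 'a set set" where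
  "edges V E = {{u, v} | u v. u \<in> V \<and> v \<in> V \<and> E u v}"

definition matchings :: "'a set \<Rightarrow> ('a \<Rightarrow> 'a \<Rightarrow> bool) \<Rightarrow> 'a set set set" where
  "matchings V E = {M. M \<subseteq> edges V E \<and> (\<forall>e\<in>M. \<forall>f\<in>M. e \<noteq> f \<longrightarrow> e \<inter> f = {})}"

definition mu_w :: "'a set \<Rightarrow> ('a \<Rightarrow> 'a \<Rightarrow> bool) \<Rightarrow> ('a set \<Rightarrow> complex) \<Rightarrow> real poly" where
  "mu_w V E w = (\<Sum>M\<in>matchings V E.
      monom ((-1) ^ card M * (cmod (\<Prod>e\<in>M. w e))\<^sup>2) (card V - 2 * card M))"

definition eta_w :: "'a set \<Rightarrow> ('a \<Rightarrow> 'a \<Rightarrow> bool) \<Rightarrow> ('a set \<Rightarrow> complex) \<Rightarrow> ('a \<Rightarrow> real) \<Rightarrow> real poly" where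
  "eta_w V E w w1 = (\<Sum>S\<in>Pow V.
      smult ((-1) ^ card (V - S) * (\<Prod>u\<in>V - S. w1 u)) (mu_w S E w))"

definition mult_w :: "real \<Rightarrow> 'a set \<Rightarrow> ('a \<Rightarrow> 'a \<Rightarrow> bool) \<Rightarrow> ('a set \<Rightarrow> complex) \<Rightarrow> ('a \<Rightarrow> real) \<Rightarrow> nat" where
  "mult_w \<theta> V E w w1 = order \<theta> (eta_w V E w w1)"

definition essential :: "real \<Rightarrow> 'a set \<Rightarrow> ('a \<Rightarrow> 'a \<Rightarrow> bool) \<Rightarrow> ('a set \<Rightarrow> complex) \<Rightarrow> ('a \<Rightarrow> real) \<Rightarrow> 'a \<Rightarrow> bool" where
  "essential \<theta> V E w w1 u \<longleftrightarrow> u \<in> V \<and>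
     int (mult_w \<theta> (V - {u}) E w w1) = int (mult_w \<theta> V E w w1) - 1"

definition special :: "real \<Rightarrow> 'a set \<Rightarrow> ('a \<Rightarrow> 'a \<Rightarrow> bool) \<Rightarrow> ('a set \<Rightarrow> complex) \<Rightarrow> ('a \<Rightarrow> real) \<Rightarrow> 'a \<Rightarrow> bool" where
  "special \<theta> V E w w1 u \<longleftrightarrow> u \<in> V \<and> \<not> essential \<theta> V E w w1 u \<and>
     (\<exists>v\<in>V. E u v \<and> essential \<theta> V E w w1 v)"

end

theory Submission
  imports Defs
begin

text \<open>Write $p_A$ for the polynomial of $G \setminus A$. The recurrence at a vertex gives, pointwise on
  the real line, a Rayleigh inequality
  $p_u p_v - p\, p_{uv} \ge |w(uv)|^2 p_{uv}^2$ (the weight being $0$ for non-adjacent $u$, $v$) and a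
  Wronskian inequality $p_u p' - p\, p_u' \ge p_u^2$. Comparing orders of vanishing at $\theta$, and using
  that a nonnegative polynomial vanishes to even order, one gets interlacing and the fact that a special
  vertex $u$ is positive, and hence the implication from $G$ to $G \setminus u$.

  Let $z$ be an essential neighbour of $u$ and suppose that $v$ is essential in $G \setminus u$ but not in
  $G$. Comparing orders forces a further neighbour $y$ of $u$ such that in $G \setminus u$ the pairs
  $y, v$ and $z, v$ behave like proportional coordinate functionals on an eigenspace, but $y, z$ like
  independent ones. This contradicts the Rayleigh inequality for $y, z$ after perturbing the weight of
  $v$: it is quadratic in the perturbation, and its discriminant vanishes to too low an order.\<close>

section \<open>Orders of vanishing and nonnegativity of real polynomials\<close>

lemma smult_sum_right: "smult c (\<Sum>i\<in>A. f i) = (\<Sum>i\<in>A. smult c (f i))"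
  by (induction A rule: infinite_finite_induct) (simp_all add: smult_add_right)

lemma pderiv_sum: "pderiv (\<Sum>i\<in>A. f i) = (\<Sum>i\<in>A. pderiv (f i))"
  using higher_pderiv_sum[of 1 f A] by simp

lemma power_dvd_pderiv:
  fixes t p :: "real poly"
  assumes "t ^ Suc n dvd p"
  shows "t ^ n dvd pderiv p"
proof -
  from assms obtain h where "p = t ^ Suc n * h" by blast
  then have "pderiv p = t ^ n * (t * pderiv h + smult (of_nat (Suc n)) (pderiv t * h))"
    by (simp only: pderiv_mult pderiv_power_Suc) (simp add: algebra_simps smult_add_left)
  then show ?thesis by simp
qed

text \<open>The term of lower order decides. The hypothesis on \<open>q\<close> is a divisibility
  and not a bound on its order, so that \<open>q = 0\<close> is covered as well.\<close>

lemma order_diff_less: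
  fixes p q :: "real poly"
  assumes "p \<noteq> 0" "[:- \<theta>, 1:] ^ Suc (order \<theta> p) dvd q"
  shows "p - q \<noteq> 0" "order \<theta> (p - q) = order \<theta> p"
proof -
  let ?t = "[:- \<theta>, 1:]"
  have p: "?t ^ order \<theta> p dvd p" "\<not> ?t ^ Suc (order \<theta> p) dvd p"
    using assms(1) order[of p \<theta>] by auto
  have n: "\<not> ?t ^ Suc (order \<theta> p) dvd p - q"
    using assms(2) p(2) by (metis dvd_add diff_add_cancel)
  then show nz: "p - q \<noteq> 0" by (metis dvd_0_right)
  have "?t ^ order \<theta> p dvd q"
    using assms(2) by (metis dvd_trans le_imp_power_dvd lessI less_imp_le)
  then have "?t ^ order \<theta> p dvd p - q" using p(1) by (rule dvd_diff[rotated])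
  then show "order \<theta> (p - q) = order \<theta> p"
    using n nz by (metis order_unique_lemma)
qed

text \<open>At a root of odd order the factor \<open>(x - \<theta>) ^ order \<theta> f\<close>
  changes sign, so the cofactor would be squeezed to the value 0 at \<theta>, against the maximality
  of the order.\<close>

lemma even_order_if_nonneg:
  fixes f :: "real poly"
  assumes "f \<noteq> 0" "\<And>x. 0 \<le> poly f x"
  shows "even (order \<theta> f)"
proof (rule ccontr)
  assume odd: "odd (order \<theta> f)"
  obtain g where g: "f = [:- \<theta>, 1:] ^ order \<theta> f * g" "\<not> [:- \<theta>, 1:] dvd g"
    using order_decomp[OF assms(1)] by blast
  have f: "poly f x = (x - \<theta>) ^ order \<theta> f * poly g x" for x
    by (subst g(1)) (simp add: algebra_simps)
  have lim: "(poly g \<longlongrightarrow> poly g \<theta>) (at \<theta> within S)" for S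
    by (intro tendsto_intros)
  have "poly g x \<ge> 0" if "x > \<theta>" for x
  proof -
    have "(x - \<theta>) ^ order \<theta> f > 0" using that by simp
    then show ?thesis using assms(2)[of x] f[of x] by (simp add: zero_le_mult_iff)
  qed
  then have "poly g \<theta> \<ge> 0"
    by (intro tendsto_lowerbound[OF lim[of "{\<theta><..}"]]) (auto simp: eventually_at_filter)
  moreover have "poly g x \<le> 0" if "x < \<theta>" for x
  proof -
    have "(x - \<theta>) ^ order \<theta> f < 0" using that odd by simp
    moreover have "0 \<le> (x - \<theta>) ^ order \<theta> f * poly g x" using assms(2)[of x] f[of x] by simp
    ultimately show ?thesis unfolding zero_le_mult_iff by linarith
  qed
  then have "poly g \<theta> \<le> 0"
    by (intro tendsto_upperbound[OF lim[of "{..<\<theta>}"]]) (auto simp: eventually_at_filter)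
  ultimately show False using g(2) by (simp add: poly_eq_0_iff_dvd)
qed

text \<open>Turns a pointwise inequality into one between orders. After division by
  \<open>(x - \<theta>) ^ (2 * order \<theta> g)\<close>, a larger \<open>n\<close> would make the
  right side tend to 0 at \<theta>, although the cofactor of \<open>g\<close> does not vanish
  there.\<close>

lemma power_dvd_le_order_square:
  fixes f g :: "real poly"
  assumes "g \<noteq> 0" "c > 0" "\<And>x. c * (poly g x)\<^sup>2 \<le> poly f x" "[:- \<theta>, 1:] ^ n dvd f"
  shows "n \<le> 2 * order \<theta> g"
proof (rule ccontr)
  assume "\<not> n \<le> 2 * order \<theta> g"
  then have "2 * order \<theta> g + 1 \<le> n" by simp
  then have "[:- \<theta>, 1:] ^ (2 * order \<theta> g + 1) dvd f"
    using assms(4) by (rule power_le_dvd[rotated])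
  then obtain k where k: "f = [:- \<theta>, 1:] ^ (2 * order \<theta> g + 1) * k" by blast
  obtain h where h: "g = [:- \<theta>, 1:] ^ order \<theta> g * h" "\<not> [:- \<theta>, 1:] dvd h"
    using order_decomp[OF assms(1)] by blast
  have gx: "poly g x = (x - \<theta>) ^ order \<theta> g * poly h x" for x
    by (subst h(1)) (simp add: algebra_simps)
  have "c * (poly h x)\<^sup>2 \<le> (x - \<theta>) * poly k x" if "x \<noteq> \<theta>" for x
  proof -
    have "poly f x = ((x - \<theta>) ^ order \<theta> g)\<^sup>2 * ((x - \<theta>) * poly k x)"
      by (simp only: k poly_mult poly_power power_add power_even_eq) (simp add: algebra_simps)
    then have "((x - \<theta>) ^ order \<theta> g)\<^sup>2 * (c * (poly h x)\<^sup>2) \<le> ((x - \<theta>) ^ order \<theta> g)\<^sup>2 * ((x - \<theta>) * poly k x)"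
      using assms(3)[of x] gx[of x] by (simp add: power_mult_distrib algebra_simps)
    then show ?thesis using that by (simp add: mult_le_cancel_left_pos)
  qed
  then have "c * (poly h \<theta>)\<^sup>2 \<le> (\<theta> - \<theta>) * poly k \<theta>"
    by (intro tendsto_le[where f = "\<lambda>x. (x - \<theta>) * poly k x" and g = "\<lambda>x. c * (poly h x)\<^sup>2" and F = "at \<theta>"]
        tendsto_intros) (auto simp: eventually_at_filter)
  then have "c * (poly h \<theta>)\<^sup>2 \<le> 0" by simp
  then have "poly h \<theta> = 0" using assms(2) by (simp add: mult_le_0_iff)
  then show False using h(2) by (simp add: poly_eq_0_iff_dvd)
qed

lemma discriminant_le:
  fixes a b c :: real
  assumes "\<And>t. 0 \<le> a + b * t + c * t\<^sup>2"
  shows "b\<^sup>2 \<le> 4 * (a * c)"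
proof (cases "c = 0")
  case True
  have "b = 0"
  proof (rule ccontr)
    assume "b \<noteq> 0"
    then show False using assms[of "- (a + 1) / b"] True by simp
  qed
  then show ?thesis using True by simp
next
  case False
  have sq: "4 * c * (a + b * t + c * t\<^sup>2) = (2 * c * t + b)\<^sup>2 - (b\<^sup>2 - 4 * (a * c))" for t
    by (simp add: algebra_simps power2_eq_square)
  show ?thesis
  proof (cases "c > 0")
    case True
    then have "0 \<le> 4 * c * (a + b * (- b / (2 * c)) + c * (- b / (2 * c))\<^sup>2)"
      using assms[of "- b / (2 * c)"] by simp
    then show ?thesis unfolding sq using True by simp
  next
    case c: False
    define D where "D = b\<^sup>2 - 4 * (a * c)"
    \<comment> \<open>Here \<open>c < 0\<close>, so \<open>sq\<close> bounds the square of
      \<open>2 * c * t + b\<close> by \<open>D\<close> for every \<open>t\<close>. This witness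
      makes the base \<open>D + 1\<close>, whose square always exceeds \<open>D\<close>.\<close>
    define t where "t = (D + 1 - b) / (2 * c)"
    have "4 * c * (a + b * t + c * t\<^sup>2) \<le> 0"
      using assms[of t] c by (simp add: mult_nonpos_nonneg)
    then have "(D + 1)\<^sup>2 \<le> D" unfolding sq D_def[symmetric] using False by (simp add: t_def)
    moreover have "(D + 1)\<^sup>2 = D + (1 + D + D\<^sup>2)" by (simp add: power2_eq_square algebra_simps)
    moreover have "0 < (1 + D) \<or> D \<le> 0" by linarith
    ultimately show ?thesis using zero_le_power2[of D] unfolding D_def by linarith
  qed
qed

section \<open>Matchings and the vertex recurrence for the edge weighted polynomial\<close>

text \<open>No vertex set is fixed: each finite \<open>S\<close> stands for its induced subgraph, so
  inductions can run over vertex sets.\<close>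

locale weighted_graph =
  fixes E :: "'a \<Rightarrow> 'a \<Rightarrow> bool" and w :: "'a set \<Rightarrow> complex"
  assumes sym: "E x y \<Longrightarrow> E y x"
    and irrefl: "\<not> E x x"
    and weight_nonzero: "E x y \<Longrightarrow> w {x, y} \<noteq> 0"
begin

lemma finite_edges: "finite S \<Longrightarrow> finite (edges S E)"
  by (rule finite_subset[of _ "Pow S"]) (auto simp: edges_def)

lemma finite_matchings: "finite S \<Longrightarrow> finite (matchings S E)"
  by (rule finite_subset[of _ "Pow (edges S E)"]) (auto simp: matchings_def finite_edges)

lemma finite_matching: "finite S \<Longrightarrow> M \<in> matchings S E \<Longrightarrow> finite M"
  using finite_edges by (auto simp: matchings_def intro: finite_subset)

text \<open>Guarantees that the exponent \<open>card S - 2 * card M\<close> is never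
  truncated.\<close>

lemma matching_card_le:
  assumes "finite S" "M \<in> matchings S E"
  shows "2 * card M \<le> card S"
proof -
  have M: "M \<subseteq> edges S E" and dj: "pairwise disjnt M"
    using assms(2) by (auto simp: matchings_def pairwise_def disjnt_def)
  have two: "card e = 2" if "e \<in> M" for e
  proof -
    from that M obtain a b where "e = {a, b}" "E a b" by (auto simp: edges_def)
    moreover from this have "a \<noteq> b" using irrefl by blast
    ultimately show ?thesis by simp
  qed
  then have "card (\<Union>M) = sum card M"
    using dj by (intro card_Union_disjoint) (auto intro: card_ge_0_finite)
  also have "\<dots> = 2 * card M" using two by simp
  finally have "2 * card M = card (\<Union>M)" by simp
  also have "\<dots> \<le> card S"
    using M assms(1) by (intro card_mono) (auto simp: edges_def)
  finally show ?thesis .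
qed

lemma edges_mono: "S \<subseteq> T \<Longrightarrow> edges S E \<subseteq> edges T E"
  by (auto simp: edges_def)

lemma matchings_mono: "S \<subseteq> T \<Longrightarrow> matchings S E \<subseteq> matchings T E"
  using edges_mono[of S T] by (simp add: matchings_def Collect_mono_iff) (meson order_trans)

lemma matching_edge_subset: "M \<in> matchings S E \<Longrightarrow> e \<in> M \<Longrightarrow> e \<subseteq> S"
  by (auto simp: matchings_def edges_def)

lemma matching_edge_at:
  assumes "M \<in> matchings S E" "e \<in> M" "u \<in> e"
  obtains y where "e = {u, y}" "y \<in> S" "E u y"
proof -
  obtain a b where ab: "e = {a, b}" "a \<in> S" "b \<in> S" "E a b"
    using assms(1,2) by (auto simp: matchings_def edges_def)
  show ?thesis
  proof (cases "u = a")
    case True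
    then show ?thesis using ab that[of b] by simp
  next
    case False
    then have "u = b" "e = {b, a}" using ab(1) assms(3) by auto
    then show ?thesis using ab sym that[of a] by simp
  qed
qed

lemma edge_subset: "e \<in> edges S E \<Longrightarrow> e \<subseteq> T \<Longrightarrow> e \<in> edges T E"
  by (auto simp: edges_def)

text \<open>Classification by the edge at \<open>u\<close>: a matching either misses
  \<open>u\<close> or contains exactly one edge \<open>{u, y}\<close>, and without that edge it
  avoids both ends.\<close>

lemma matchings_insert:
  assumes "u \<notin> S"
  shows "matchings (insert u S) E =
    matchings S E \<union> (\<Union>y\<in>{y \<in> S. E u y}. insert {u, y} ` matchings (S - {y}) E)" (is "?L = ?R")
proof
  show "?R \<subseteq> ?L"
  proof
    fix M assume "M \<in> ?R"
    then show "M \<in> ?L"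
    proof
      assume "M \<in> matchings S E"
      then show ?thesis using matchings_mono[of S "insert u S"] by blast
    next
      assume "M \<in> (\<Union>y\<in>{y \<in> S. E u y}. insert {u, y} ` matchings (S - {y}) E)"
      then obtain y N where y: "y \<in> S" "E u y" and M: "M = insert {u, y} N"
        and N: "N \<in> matchings (S - {y}) E" by blast
      have "{u, y} \<in> edges (insert u S) E" using y by (auto simp: edges_def)
      moreover have "f \<inter> {u, y} = {}" "{u, y} \<inter> f = {}" if "f \<in> N" for f
        using matching_edge_subset[OF N that] assms by blast+
      moreover have "N \<in> matchings (insert u S) E"
        using N matchings_mono[of "S - {y}" "insert u S"] by blast
      ultimately show ?thesis unfolding M matchings_def by simp
    qed
  qed
  show "?L \<subseteq> ?R"
  proof
    fix M assume M: "M \<in> ?L"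
    show "M \<in> ?R"
    proof (cases "\<exists>e\<in>M. u \<in> e")
      case False
      have "M \<subseteq> edges S E"
      proof
        fix e assume e: "e \<in> M"
        then have "e \<in> edges (insert u S) E" using M by (auto simp: matchings_def)
        moreover have "e \<subseteq> S" using matching_edge_subset[OF M e] False e by blast
        ultimately show "e \<in> edges S E" by (rule edge_subset)
      qed
      then have "M \<in> matchings S E" using M unfolding matchings_def by simp
      then show ?thesis ..
    next
      case True
      then obtain e where e: "e \<in> M" "u \<in> e" by blast
      obtain y where y: "e = {u, y}" "y \<in> insert u S" "E u y"
        using matching_edge_at[OF M e] .
      have yS: "y \<in> S" using y irrefl by blast
      have "f \<in> edges (S - {y}) E" if f: "f \<in> M" "f \<noteq> e" for f
      proof (rule edge_subset)
        show "f \<in> edges (insert u S) E" using f M by (auto simp: matchings_def)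
        have "f \<inter> e = {}" using M f e(1) by (simp add: matchings_def)
        then show "f \<subseteq> S - {y}" using matching_edge_subset[OF M f(1)] y(1) by blast
      qed
      then have "M - {e} \<in> matchings (S - {y}) E"
        using M by (simp add: matchings_def subset_iff)
      moreover have "M = insert {u, y} (M - {e})" using e y by blast
      ultimately show ?thesis using y yS by blast
    qed
  qed
qed

text \<open>The value 0 for non-adjacent pairs lets the recurrences sum over all vertices and the
  Rayleigh inequality hold for all pairs.\<close>

definition edge_sq :: "'a \<Rightarrow> 'a \<Rightarrow> real" where
  "edge_sq u y = (if E u y then (cmod (w {u, y}))\<^sup>2 else 0)"

lemma edge_sq_nonneg: "0 \<le> edge_sq u y"
  by (simp add: edge_sq_def)

lemma edge_sq_pos: "E u y \<Longrightarrow> 0 < edge_sq u y"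
  by (simp add: edge_sq_def weight_nonzero)

text \<open>Matchings that miss \<open>u\<close> gain a factor x from the extra vertex; those
  through \<open>{u, y}\<close> gain a sign and the squared modulus of that edge weight.\<close>

lemma mu_insert:
  assumes "finite S" "u \<notin> S"
  shows "mu_w (insert u S) E w =
    [:0, 1:] * mu_w S E w - (\<Sum>y\<in>S. smult (edge_sq u y) (mu_w (S - {y}) E w))"
proof -
  define T where "T n M = monom ((-1) ^ card M * (cmod (\<Prod>e\<in>M. w e))\<^sup>2) (n - 2 * card M)"
    for n and M :: "'a set set"
  have mu: "mu_w X E w = (\<Sum>M\<in>matchings X E. T (card X) M)" for X
    by (simp add: mu_w_def T_def)
  let ?N = "{y \<in> S. E u y}"
  let ?B = "\<lambda>y. insert {u, y} ` matchings (S - {y}) E"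
  have notin: "\<And>e. M \<in> matchings X E \<Longrightarrow> e \<in> M \<Longrightarrow> X \<subseteq> S \<Longrightarrow> u \<notin> e" for M X
    using assms(2) matching_edge_subset by blast
  have "mu_w (insert u S) E w =
      (\<Sum>M\<in>matchings S E. T (Suc (card S)) M) + (\<Sum>M\<in>(\<Union>y\<in>?N. ?B y). T (Suc (card S)) M)"
    unfolding mu matchings_insert[OF assms(2)]
    using assms notin by (subst sum.union_disjoint) (auto simp: finite_matchings)
  also have "(\<Sum>M\<in>matchings S E. T (Suc (card S)) M) = [:0, 1:] * mu_w S E w"
    unfolding mu sum_distrib_left
  proof (rule sum.cong[OF refl])
    fix M assume "M \<in> matchings S E"
    then have "2 * card M \<le> card S" by (rule matching_card_le[OF assms(1)])
    then have "Suc (card S) - 2 * card M = Suc (card S - 2 * card M)" by simp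
    then show "T (Suc (card S)) M = [:0, 1:] * T (card S) M"
      by (simp add: T_def monom_Suc)
  qed
  also have "(\<Sum>M\<in>(\<Union>y\<in>?N. ?B y). T (Suc (card S)) M) = (\<Sum>y\<in>?N. \<Sum>M\<in>?B y. T (Suc (card S)) M)"
  proof (rule sum.UNION_disjoint)
    show "\<forall>y\<in>?N. \<forall>z\<in>?N. y \<noteq> z \<longrightarrow> ?B y \<inter> ?B z = {}"
    proof (intro ballI impI, rule ccontr)
      fix y z assume yz: "y \<in> ?N" "z \<in> ?N" "y \<noteq> z" "?B y \<inter> ?B z \<noteq> {}"
      then obtain M N where MN: "insert {u, y} M = insert {u, z} N" "N \<in> matchings (S - {z}) E"
        by blast
      then have "{u, y} \<in> insert {u, z} N" by blast
      then have "{u, y} \<in> N" using yz(3) by (auto simp: doubleton_eq_iff)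
      then show False using notin[OF MN(2)] by blast
    qed
  qed (use assms in \<open>auto simp: finite_matchings\<close>)
  also have "\<dots> = (\<Sum>y\<in>?N. - smult (edge_sq u y) (mu_w (S - {y}) E w))"
  proof (rule sum.cong[OF refl])
    fix y assume y: "y \<in> ?N"
    let ?X = "matchings (S - {y}) E"
    have nm: "{u, y} \<notin> M" if "M \<in> ?X" for M using notin[OF that] by blast
    have inj: "inj_on (insert {u, y}) ?X"
      by (rule inj_onI) (metis nm insert_ident)
    have "(\<Sum>M\<in>?B y. T (Suc (card S)) M) = (\<Sum>M\<in>?X. T (Suc (card S)) (insert {u, y} M))"
      using inj by (simp add: sum.reindex)
    also have "\<dots> = (\<Sum>M\<in>?X. - smult (edge_sq u y) (T (card (S - {y})) M))"
    proof (rule sum.cong[OF refl])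
      fix M assume M: "M \<in> ?X"
      have fin: "finite M" using assms(1) M by (auto intro: finite_matching[of "S - {y}"])
      have "card S > 0" using y assms(1) by (auto simp: card_gt_0_iff)
      then have "Suc (card S) - 2 * card (insert {u, y} M) = card (S - {y}) - 2 * card M"
        using y assms(1) fin nm[OF M] by simp
      then show "T (Suc (card S)) (insert {u, y} M) = - smult (edge_sq u y) (T (card (S - {y})) M)"
        using fin nm[OF M] y
        by (simp add: T_def edge_sq_def smult_monom norm_mult power_mult_distrib algebra_simps flip: minus_monom)
    qed
    finally show "(\<Sum>M\<in>?B y. T (Suc (card S)) M) = - smult (edge_sq u y) (mu_w (S - {y}) E w)"
      by (simp add: mu sum_negf smult_sum_right)
  qed
  also have "\<dots> = - (\<Sum>y\<in>S. smult (edge_sq u y) (mu_w (S - {y}) E w))"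
    unfolding sum_negf
    using assms(1) by (intro arg_cong[where f = uminus] sum.mono_neutral_left) (auto simp: edge_sq_def)
  finally show ?thesis by simp
qed

section \<open>The vertex recurrence for the weighted matching polynomial\<close>

abbreviation eta :: "('a \<Rightarrow> real) \<Rightarrow> 'a set \<Rightarrow> real poly" where
  "eta w1 S \<equiv> eta_w S E w w1"

lemma eta_empty: "eta w1 {} = 1"
proof -
  have "matchings {} E = {{}}" by (auto simp: matchings_def edges_def)
  then show ?thesis by (simp add: eta_w_def mu_w_def)
qed

text \<open>Split the subsets by membership of \<open>u\<close>. Those without \<open>u\<close> give
  the factor \<open>- w1 u\<close>; to those with \<open>u\<close> apply \<open>mu_insert\<close>,
  then exchange the sums over \<open>X\<close> and \<open>y\<close>. Since \<open>y\<close> is in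
  \<open>X\<close>, its weight does not enter the coefficient, which is therefore that of
  \<open>X - {y}\<close> in \<open>S - {y}\<close>.\<close>

lemma eta_insert:
  assumes "finite S" "u \<notin> S"
  shows "eta w1 (insert u S) =
    [:- w1 u, 1:] * eta w1 S - (\<Sum>y\<in>S. smult (edge_sq u y) (eta w1 (S - {y})))"
proof -
  define c where "c V X = (-1) ^ card (V - X) * (\<Prod>u\<in>V - X. w1 u)" for V X
  have eta: "eta w1 V = (\<Sum>X\<in>Pow V. smult (c V X) (mu_w X E w))" for V
    by (simp add: eta_w_def c_def)
  have sub: "X \<subseteq> S \<Longrightarrow> finite X \<and> u \<notin> X" for X using assms finite_subset by blast
  have c1: "c (insert u S) X = - w1 u * c S X" if "X \<subseteq> S" for X
  proof -
    have "insert u S - X = insert u (S - X)" using that assms by blast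
    then show ?thesis using assms by (simp add: c_def)
  qed
  have c2: "c (insert u S) (insert u X) = c S X" if "X \<subseteq> S" for X
  proof -
    have "insert u S - insert u X = S - X" using that assms by blast
    then show ?thesis by (simp add: c_def)
  qed
  have c3: "c S (insert y X) = c (S - {y}) X" for X y
  proof -
    have "S - insert y X = S - {y} - X" by blast
    then show ?thesis by (simp add: c_def)
  qed
  have inj: "inj_on (insert u) (Pow S)" using assms by (intro inj_onI) (metis PowD insert_ident subsetD)
  have "eta w1 (insert u S) = (\<Sum>X\<in>Pow S. smult (c (insert u S) X) (mu_w X E w)) +
      (\<Sum>X\<in>insert u ` Pow S. smult (c (insert u S) X) (mu_w X E w))"
    unfolding eta Pow_insert using assms by (intro sum.union_disjoint) auto
  also have "(\<Sum>X\<in>Pow S. smult (c (insert u S) X) (mu_w X E w)) = smult (- w1 u) (eta w1 S)"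
    unfolding eta smult_sum_right by (intro sum.cong) (auto simp: c1)
  also have "(\<Sum>X\<in>insert u ` Pow S. smult (c (insert u S) X) (mu_w X E w)) =
      (\<Sum>X\<in>Pow S. smult (c S X) (mu_w (insert u X) E w))"
    by (subst sum.reindex[OF inj], rule sum.cong) (auto simp: c2)
  also have "\<dots> = (\<Sum>X\<in>Pow S. smult (c S X) ([:0, 1:] * mu_w X E w)) -
      (\<Sum>X\<in>Pow S. \<Sum>y\<in>X. smult (edge_sq u y) (smult (c S X) (mu_w (X - {y}) E w)))"
    unfolding sum_subtractf[symmetric]
    by (intro sum.cong) (auto simp: sub mu_insert smult_diff_right smult_sum_right mult.commute)
  also have "(\<Sum>X\<in>Pow S. smult (c S X) ([:0, 1:] * mu_w X E w)) = [:0, 1:] * eta w1 S"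
    by (simp add: eta sum_distrib_left)
  also have "(\<Sum>X\<in>Pow S. \<Sum>y\<in>X. smult (edge_sq u y) (smult (c S X) (mu_w (X - {y}) E w))) =
      (\<Sum>y\<in>S. \<Sum>X\<in>{X \<in> Pow S. y \<in> X}. smult (edge_sq u y) (smult (c S X) (mu_w (X - {y}) E w)))"
  proof -
    have "(\<Sum>X\<in>Pow S. \<Sum>y\<in>X. g X y) = (\<Sum>y\<in>S. \<Sum>X\<in>{X \<in> Pow S. y \<in> X}. g X y)"
      for g :: "'a set \<Rightarrow> 'a \<Rightarrow> real poly"
    proof -
      have "(\<Sum>X\<in>Pow S. \<Sum>y\<in>X. g X y) = (\<Sum>X\<in>Pow S. \<Sum>y\<in>{y \<in> S. y \<in> X}. g X y)"
        by (intro sum.cong) auto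
      also have "\<dots> = (\<Sum>y\<in>S. \<Sum>X\<in>{X \<in> Pow S. y \<in> X}. g X y)"
        using assms(1) by (intro sum.swap_restrict) auto
      finally show ?thesis .
    qed
    then show ?thesis .
  qed
  also have "\<dots> = (\<Sum>y\<in>S. smult (edge_sq u y) (eta w1 (S - {y})))"
  proof (rule sum.cong[OF refl])
    fix y assume y: "y \<in> S"
    have "(\<Sum>X\<in>{X \<in> Pow S. y \<in> X}. smult (edge_sq u y) (smult (c S X) (mu_w (X - {y}) E w))) =
        (\<Sum>X\<in>Pow (S - {y}). smult (edge_sq u y) (smult (c (S - {y}) X) (mu_w X E w)))"
      by (rule sum.reindex_bij_witness[where i = "insert y" and j = "\<lambda>X. X - {y}"])
        (use y in \<open>auto simp: insert_absorb simp flip: c3\<close>)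
    then show "(\<Sum>X\<in>{X \<in> Pow S. y \<in> X}. smult (edge_sq u y) (smult (c S X) (mu_w (X - {y}) E w))) =
        smult (edge_sq u y) (eta w1 (S - {y}))"
      by (simp add: eta smult_sum_right)
  qed
  finally show ?thesis by (simp add: algebra_simps)
qed

section \<open>Rayleigh, Wronskian and discriminant inequalities on the real line\<close>

lemma poly_eta_remove:
  assumes "finite S" "u \<in> S"
  shows "poly (eta w1 S) x = (x - w1 u) * poly (eta w1 (S - {u})) x -
    (\<Sum>y\<in>S - {u}. edge_sq u y * poly (eta w1 (S - {u, y})) x)"
proof -
  have "S - {u, y} = S - {u} - {y}" for y by blast
  then show ?thesis
    using arg_cong[OF eta_insert[of "S - {u}" u w1], of "\<lambda>p. poly p x"] assms
    by (simp add: insert_absorb poly_sum algebra_simps)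
qed

text \<open>The right-hand side is a sum over all paths from u to v (Heilmann--Lieb identity); only the one-edge
  path is kept on the left.\<close>

lemma eta_rayleigh:
  assumes "finite S" "u \<in> S" "v \<in> S" "u \<noteq> v"
  shows "edge_sq u v * (poly (eta w1 (S - {u, v})) x)\<^sup>2 \<le>
    poly (eta w1 (S - {u})) x * poly (eta w1 (S - {v})) x -
    poly (eta w1 S) x * poly (eta w1 (S - {u, v})) x"
  using assms
proof (induction "card S" arbitrary: S u v rule: less_induct)
  case less
  let ?p = "\<lambda>A. poly (eta w1 (S - A)) x"
  let ?s = "\<lambda>y. edge_sq u y"
  let ?Y = "S - {u, v}"
  have Y: "finite ?Y" "v \<notin> ?Y" "S - {u} = insert v ?Y" using less.prems by auto
  have 1: "poly (eta w1 S) x = (x - w1 u) * ?p {u} - (?s v * ?p {u, v} + (\<Sum>y\<in>?Y. ?s y * ?p {u, y}))"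
    using poly_eta_remove[of S u w1 x] less.prems Y by simp
  have 2: "?p {v} = (x - w1 u) * ?p {u, v} - (\<Sum>y\<in>?Y. ?s y * ?p {u, v, y})"
  proof -
    have "S - {v} - {u} = ?Y" "\<And>y. S - {v} - {u, y} = S - {u, v, y}" by blast+
    then show ?thesis using poly_eta_remove[of "S - {v}" u w1 x] less.prems by simp
  qed
  \<comment> \<open>After expansion of both polynomials at \<open>u\<close>, the Rayleigh difference
    is the one-edge term plus this sum. Its summands are Rayleigh differences of \<open>y\<close>
    and \<open>v\<close> in \<open>S - {u}\<close>, nonnegative by induction.\<close>
  have "0 \<le> (\<Sum>y\<in>?Y. ?s y * (?p {u, y} * ?p {u, v} - ?p {u} * ?p {u, v, y}))"
  proof (intro sum_nonneg mult_nonneg_nonneg edge_sq_nonneg)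
    fix y assume y: "y \<in> ?Y"
    have e: "S - {u} - {y} = S - {u, y}" "S - {u} - {v} = S - {u, v}" "S - {u} - {y, v} = S - {u, v, y}"
      by blast+
    have "card (S - {u}) < card S" using less.prems by (intro psubset_card_mono) auto
    then have "edge_sq y v * (?p {u, v, y})\<^sup>2 \<le> ?p {u, y} * ?p {u, v} - ?p {u} * ?p {u, v, y}"
      using less.hyps[of "S - {u}" y v] less.prems y unfolding e by auto
    then show "0 \<le> ?p {u, y} * ?p {u, v} - ?p {u} * ?p {u, v, y}"
      using edge_sq_nonneg[of y v] by (meson order_trans mult_nonneg_nonneg zero_le_power2)
  qed
  also have "\<dots> = (\<Sum>y\<in>?Y. ?s y * ?p {u, y}) * ?p {u, v} - ?p {u} * (\<Sum>y\<in>?Y. ?s y * ?p {u, v, y})"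
    by (simp add: sum_distrib_left sum_distrib_right sum_subtractf algebra_simps)
  finally show ?case unfolding 1 2 by (simp add: algebra_simps power2_eq_square)
qed

text \<open>Christoffel-Darboux type identity: the recurrence at \<open>u\<close> makes the
  Wronskian equal to the square plus a nonnegative combination of Wronskians for
  \<open>S - {u}\<close> and its vertices \<open>y\<close>.\<close>

lemma eta_wronskian:
  assumes "finite S" "u \<in> S"
  shows "(poly (eta w1 (S - {u})) x)\<^sup>2 \<le>
    poly (eta w1 (S - {u}) * pderiv (eta w1 S) - eta w1 S * pderiv (eta w1 (S - {u}))) x"
  using assms
proof (induction "card S" arbitrary: S u rule: less_induct)
  case less
  let ?Y = "S - {u}"
  let ?q = "eta w1 ?Y"
  let ?r = "\<lambda>y. eta w1 (?Y - {y})"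
  let ?s = "\<lambda>y. edge_sq u y"
  have p: "eta w1 S = [:- w1 u, 1:] * ?q - (\<Sum>y\<in>?Y. smult (?s y) (?r y))"
    using eta_insert[of ?Y u w1] less.prems by (simp add: insert_absorb)
  have pd: "pderiv (eta w1 S) = ?q + [:- w1 u, 1:] * pderiv ?q - (\<Sum>y\<in>?Y. smult (?s y) (pderiv (?r y)))"
    unfolding p pderiv_diff pderiv_mult pderiv_sum pderiv_smult by (simp add: pderiv_pCons)
  have "0 \<le> (\<Sum>y\<in>?Y. ?s y * poly (?r y * pderiv ?q - ?q * pderiv (?r y)) x)"
  proof (intro sum_nonneg mult_nonneg_nonneg edge_sq_nonneg)
    fix y assume y: "y \<in> ?Y"
    have "card ?Y < card S" using less.prems by (intro psubset_card_mono) auto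
    then show "0 \<le> poly (?r y * pderiv ?q - ?q * pderiv (?r y)) x"
      using less.hyps[of ?Y y] less.prems y by (meson finite_Diff order_trans zero_le_power2)
  qed
  also have "\<dots> = (\<Sum>y\<in>?Y. ?s y * poly (?r y) x) * poly (pderiv ?q) x -
      poly ?q x * (\<Sum>y\<in>?Y. ?s y * poly (pderiv (?r y)) x)"
    by (simp add: sum_distrib_left sum_distrib_right sum_subtractf algebra_simps)
  finally show ?case unfolding pd
    by (simp add: p poly_sum algebra_simps power2_eq_square)
qed

lemma eta_nonzero: "finite S \<Longrightarrow> eta w1 S \<noteq> 0"
proof (induction S rule: finite_induct)
  case empty
  then show ?case by (simp add: eta_empty)
next
  case (insert u S)
  show ?case
  proof
    assume "eta w1 (insert u S) = 0"
    then have "(poly (eta w1 S) x)\<^sup>2 \<le> 0" for x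
      using eta_wronskian[of "insert u S" u w1 x] insert.hyps by simp
    then have "poly (eta w1 S) x = 0" for x by simp
    then show False using insert.IH poly_all_0_iff_0 by blast
  qed
qed

lemma eta_upd:
  assumes "finite S" "v \<notin> S"
  shows "eta (w1(v := a)) S = eta w1 S"
proof -
  have "(\<Prod>u\<in>S - X. (w1(v := a)) u) = (\<Prod>u\<in>S - X. w1 u)" for X
    using assms by (intro prod.cong) auto
  then show ?thesis by (simp add: eta_w_def)
qed

text \<open>The polynomial is affine in the weight of \<open>v\<close>, with slope given by deleting
  \<open>v\<close>; this is the perturbation used below.\<close>

lemma poly_eta_shift:
  assumes "finite S" "v \<in> S"
  shows "poly (eta (w1(v := w1 v - c)) S) x = poly (eta w1 S) x + c * poly (eta w1 (S - {v})) x"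
  using assms by (simp add: poly_eta_remove[OF assms] eta_upd algebra_simps)

text \<open>Lower the weight of \<open>v\<close> by \<open>c\<close>. The Rayleigh difference of
  \<open>y\<close> and \<open>z\<close> becomes a quadratic in \<open>c\<close>, nonnegative for all
  real \<open>c\<close>, whose outer coefficients are the Rayleigh differences in \<open>S\<close>
  and in \<open>S - {v}\<close>.\<close>

lemma eta_discriminant:
  assumes "finite S" "y \<in> S" "z \<in> S" "v \<in> S" "y \<noteq> z" "y \<noteq> v" "z \<noteq> v"
    and p_def: "p = (\<lambda>A. poly (eta w1 (S - A)) x)"
  shows "(p {y} * p {z, v} + p {y, v} * p {z} - p {} * p {y, z, v} - p {v} * p {y, z})\<^sup>2 \<le>
    4 * ((p {y} * p {z} - p {} * p {y, z}) * (p {y, v} * p {z, v} - p {v} * p {y, z, v}))"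
proof (rule discriminant_le)
  fix c
  let ?w = "w1(v := w1 v - c)"
  have sh: "poly (eta ?w (S - A)) x = p A + c * p (insert v A)" if "v \<notin> A" for A
    using poly_eta_shift[of "S - A" v w1 c x] that assms(1,4) unfolding p_def
    by (simp add: Diff_insert[symmetric])
  have "0 \<le> edge_sq y z * (poly (eta ?w (S - {y, z})) x)\<^sup>2"
    by (simp add: edge_sq_nonneg)
  also have "\<dots> \<le> poly (eta ?w (S - {y})) x * poly (eta ?w (S - {z})) x -
      poly (eta ?w (S - {})) x * poly (eta ?w (S - {y, z})) x"
    using eta_rayleigh[of S y z ?w x] assms by simp
  also have "\<dots> = (p {y} * p {z} - p {} * p {y, z}) +
      (p {y} * p {z, v} + p {y, v} * p {z} - p {} * p {y, z, v} - p {v} * p {y, z}) * c +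
      (p {y, v} * p {z, v} - p {v} * p {y, z, v}) * c\<^sup>2"
    using assms(6,7) sh[of "{}"] sh[of "{y}"] sh[of "{z}"] sh[of "{y, z}"]
    by (simp add: insert_commute algebra_simps power2_eq_square)
  finally show "0 \<le> \<dots>" .
qed


section \<open>Orders of vanishing at \<theta> under vertex deletion: interlacing, parity and
  adjacency\<close>

context
  fixes V :: "'a set" and w1 :: "'a \<Rightarrow> real" and \<theta> :: real
  assumes fin: "finite V"
begin

text \<open>Indexed by the deleted set, so that successive deletions become nested
  \<open>insert\<close>s over one fixed \<open>V\<close>.\<close>

definition rem_mult :: "'a set \<Rightarrow> nat" where
  "rem_mult A = order \<theta> (eta w1 (V - A))"

lemma eta_rem_nonzero: "eta w1 (V - A) \<noteq> 0"
  using fin by (simp add: eta_nonzero)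

lemma power_dvd_eta: "n \<le> rem_mult A \<Longrightarrow> [:- \<theta>, 1:] ^ n dvd eta w1 (V - A)"
  by (simp add: rem_mult_def order_divides)

lemma power_dvd_eta_mult:
  "n \<le> rem_mult A + rem_mult B \<Longrightarrow> [:- \<theta>, 1:] ^ n dvd eta w1 (V - A) * eta w1 (V - B)"
  by (simp add: rem_mult_def order_divides order_mult eta_rem_nonzero)

lemma rem_rayleigh:
  assumes "u \<in> V - A" "v \<in> V - A" "u \<noteq> v"
  shows "edge_sq u v * (poly (eta w1 (V - insert u (insert v A))) x)\<^sup>2 \<le>
    poly (eta w1 (V - insert u A) * eta w1 (V - insert v A) -
      eta w1 (V - A) * eta w1 (V - insert u (insert v A))) x"
proof -
  have "V - A - {u} = V - insert u A" "V - A - {v} = V - insert v A"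
    "V - A - {u, v} = V - insert u (insert v A)" by blast+
  then show ?thesis using eta_rayleigh[of "V - A" u v w1 x] assms fin by simp
qed

text \<open>First half of interlacing. If deleting \<open>u\<close> lowered the order to
  \<open>j\<close> from at least \<open>j + 2\<close>, the Wronskian would vanish to order
  \<open>2 * j + 1\<close>, but it dominates a square of order \<open>2 * j\<close>.\<close>

lemma rem_mult_le_insert:
  assumes "u \<in> V - A"
  shows "rem_mult A \<le> Suc (rem_mult (insert u A))"
proof (rule ccontr)
  let ?t = "[:- \<theta>, 1:]" and ?p = "eta w1 (V - A)" and ?q = "eta w1 (V - insert u A)"
  define j where "j = rem_mult (insert u A)"
  assume "\<not> ?thesis"
  then have k: "Suc (Suc j) \<le> rem_mult A" by (simp add: j_def)
  have q: "V - A - {u} = V - insert u A" by blast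
  have p: "?t ^ Suc (Suc j) dvd ?p" by (rule power_dvd_eta[OF k])
  then have p': "?t ^ Suc j dvd pderiv ?p" by (rule power_dvd_pderiv)
  have q0: "?t ^ j dvd ?q" by (simp add: power_dvd_eta j_def)
  \<comment> \<open>For \<open>j = 0\<close> the truncated exponent is 0 and the claim is trivial;
    the total \<open>j + 2 + (j - 1)\<close> is at least \<open>2 * j + 1\<close> in either
    case.\<close>
  have q': "?t ^ (j - 1) dvd pderiv ?q"
  proof (cases j)
    case (Suc i)
    then show ?thesis using power_dvd_pderiv[of ?t i ?q] q0 by simp
  qed simp
  have "?t ^ (j + Suc j) dvd ?q * pderiv ?p"
    unfolding power_add by (rule mult_dvd_mono[OF q0 p'])
  moreover have "?t ^ (Suc (Suc j) + (j - 1)) dvd ?p * pderiv ?q"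
    unfolding power_add by (rule mult_dvd_mono[OF p q'])
  then have "?t ^ (j + Suc j) dvd ?p * pderiv ?q"
    by (rule dvd_trans[OF le_imp_power_dvd, rotated]) simp
  ultimately have "?t ^ (j + Suc j) dvd ?q * pderiv ?p - ?p * pderiv ?q" by (rule dvd_diff)
  then have "j + Suc j \<le> 2 * order \<theta> ?q"
    using eta_wronskian[of "V - A" u w1] assms fin unfolding q
    by (intro power_dvd_le_order_square[where c = 1]) (auto simp: eta_rem_nonzero)
  then show False by (simp add: j_def rem_mult_def)
qed

text \<open>Expand the polynomial at u: if every term vanished to higher order, so would the sum.\<close>

lemma ex_neighbour_rem_mult:
  assumes "u \<in> V - A" "rem_mult A < rem_mult (insert u A)"
  shows "\<exists>y\<in>V - insert u A. E u y \<and> rem_mult (insert u (insert y A)) \<le> rem_mult A"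
proof (rule ccontr)
  assume neg: "\<not> ?thesis"
  let ?t = "[:- \<theta>, 1:]" and ?n = "Suc (rem_mult A)"
  have ins: "V - A = insert u (V - insert u A)" using assms(1) by blast
  have "?t ^ ?n dvd eta w1 (V - A)"
    unfolding ins
  proof (subst eta_insert, goal_cases)
    case 3
    have "?t ^ ?n dvd eta w1 (V - insert u A)" using assms(2) by (intro power_dvd_eta) simp
    moreover have "?t ^ ?n dvd smult (edge_sq u y) (eta w1 (V - insert u A - {y}))"
      if y: "y \<in> V - insert u A" for y
    proof (cases "E u y")
      case True
      then have "?n \<le> rem_mult (insert u (insert y A))" using neg y by force
      moreover have "V - insert u A - {y} = V - insert u (insert y A)" by blast
      ultimately show ?thesis by (metis power_dvd_eta dvd_smult)
    qed (simp add: edge_sq_def)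
    ultimately show ?case by (intro dvd_diff dvd_mult dvd_sum) 
  qed (use fin in auto)
  then have "?n \<le> order \<theta> (eta w1 (V - A))"
    using eta_rem_nonzero order_divides by blast
  then show False by (simp add: rem_mult_def)
qed

text \<open>Second half of interlacing. After a jump by two or more, some neighbour \<open>y\<close>
  would bring the order back to at most \<open>rem_mult A\<close>, which is a drop by more than
  one.\<close>

lemma rem_mult_insert_le:
  assumes "u \<in> V - A"
  shows "rem_mult (insert u A) \<le> Suc (rem_mult A)"
proof (rule ccontr)
  assume neg: "\<not> ?thesis"
  then obtain y where y: "y \<in> V - insert u A" "rem_mult (insert u (insert y A)) \<le> rem_mult A"
    using ex_neighbour_rem_mult[OF assms] by force
  then show False using rem_mult_le_insert[of y "insert u A"] neg by (simp add: insert_commute)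
qed

text \<open>When the two products in the Rayleigh difference have different orders, the difference
  has the smaller one as its order, and it is nonnegative.\<close>

lemma rem_mult_parity:
  assumes "u \<in> V - A" "v \<in> V - A" "u \<noteq> v"
  defines "a \<equiv> rem_mult (insert u A) + rem_mult (insert v A)"
    and "b \<equiv> rem_mult A + rem_mult (insert u (insert v A))"
  assumes "a \<noteq> b"
  shows "even (min a b)"
proof -
  let ?f = "eta w1 (V - insert u A) * eta w1 (V - insert v A)"
  let ?g = "eta w1 (V - A) * eta w1 (V - insert u (insert v A))"
  have nz: "?f \<noteq> 0" "?g \<noteq> 0" by (simp_all add: eta_rem_nonzero)
  have o: "order \<theta> ?f = a" "order \<theta> ?g = b"
    using nz by (simp_all add: order_mult rem_mult_def a_def b_def)
  have "0 \<le> poly (?f - ?g) x" for x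
    using rem_rayleigh[OF assms(1-3), of x] edge_sq_nonneg[of u v]
    by (meson order_trans mult_nonneg_nonneg zero_le_power2)
  then have even: "?f - ?g \<noteq> 0 \<Longrightarrow> even (order \<theta> (?f - ?g))"
    using even_order_if_nonneg by blast
  consider "a < b" | "b < a" using assms(6) by linarith
  then show ?thesis
  proof cases
    case 1
    then have "[:- \<theta>, 1:] ^ Suc (order \<theta> ?f) dvd ?g"
      unfolding o b_def by (intro power_dvd_eta_mult) simp
    from order_diff_less[OF nz(1) this] even show ?thesis using 1 by (simp add: o)
  next
    case 2
    then have "[:- \<theta>, 1:] ^ Suc (order \<theta> ?g) dvd ?f"
      unfolding o a_def by (intro power_dvd_eta_mult) simp
    from order_diff_less[OF nz(2) this]
    have "?f - ?g \<noteq> 0" "order \<theta> (?f - ?g) = b"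
      using order_uminus[of \<theta> "?g - ?f"] by (auto simp: o)
    with even show ?thesis using 2 by simp
  qed
qed

text \<open>For adjacent vertices the Rayleigh difference dominates a positive multiple of a square,
  so a power of the linear factor dividing both products bounds the order of that square from
  below.\<close>

lemma rem_mult_edge:
  assumes "u \<in> V - A" "v \<in> V - A" "E u v"
    and "n \<le> rem_mult (insert u A) + rem_mult (insert v A)"
    and "n \<le> rem_mult A + rem_mult (insert u (insert v A))"
  shows "n \<le> 2 * rem_mult (insert u (insert v A))"
proof -
  have "u \<noteq> v" using assms(3) irrefl by blast
  then show ?thesis
    unfolding rem_mult_def[of "insert u (insert v A)"]
    using assms by (intro power_dvd_le_order_square[OF eta_rem_nonzero edge_sq_pos rem_rayleigh])
      (auto intro!: dvd_diff power_dvd_eta_mult)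
qed

text \<open>With n the order bound on the outer coefficients of the quadratic in the perturbation, the single term
  of lowest order in its middle coefficient is the one for v and y, z.\<close>

lemma rem_mult_discriminant:
  assumes "y \<in> V - A" "z \<in> V - A" "v \<in> V - A" "y \<noteq> z" "y \<noteq> v" "z \<noteq> v"
  defines "m \<equiv> \<lambda>B. rem_mult (B \<union> A)"
  assumes "n \<le> m {y} + m {z}" "n \<le> m {} + m {y, z}"
    and "n \<le> m {y, v} + m {z, v}" "n \<le> m {v} + m {y, z, v}"
    and "m {v} + m {y, z} < m {y} + m {z, v}" "m {v} + m {y, z} < m {y, v} + m {z}"
    and "m {v} + m {y, z} < m {} + m {y, z, v}"
  shows "n \<le> m {v} + m {y, z}"
proof -
  let ?t = "[:- \<theta>, 1:]"
  let ?p = "\<lambda>B. eta w1 (V - (B \<union> A))"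
  have e: "V - A - B = V - (B \<union> A)" for B by blast
  let ?N = "?p {v} * ?p {y, z}"
  let ?R = "?p {y} * ?p {z, v} + ?p {y, v} * ?p {z} - ?p {} * ?p {y, z, v}"
  have N: "?N \<noteq> 0" by (simp add: eta_rem_nonzero)
  have o: "order \<theta> ?N = m {v} + m {y, z}"
    unfolding rem_mult_def m_def using N by (rule order_mult)
  have "?t ^ Suc (order \<theta> ?N) dvd ?R"
    unfolding o using assms(12-14) unfolding m_def
    by (intro dvd_diff dvd_add power_dvd_eta_mult) simp_all
  note d = order_diff_less[OF N this]
  let ?D = "smult 4 ((?p {y} * ?p {z} - ?p {} * ?p {y, z}) * (?p {y, v} * ?p {z, v} - ?p {v} * ?p {y, z, v}))"
  have "?t ^ (n + n) dvd ?D"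
    unfolding power_add using assms(8-11) unfolding m_def
    by (intro dvd_smult mult_dvd_mono dvd_diff power_dvd_eta_mult) simp_all
  moreover have "1 * (poly (?N - ?R) x)\<^sup>2 \<le> poly ?D x" for x
    using eta_discriminant[of "V - A" y z v _ w1 x, OF _ assms(1-6) refl] fin unfolding e
    by (simp add: power2_commute algebra_simps)
  ultimately have "n + n \<le> 2 * order \<theta> (?N - ?R)"
    using d(1) by (intro power_dvd_le_order_square[where c = 1]) auto
  then show ?thesis using d(2) o by simp
qed

text \<open>Otherwise the order of the Rayleigh difference at u, y would exceed that of its lower bound.\<close>

lemma rem_mult_neighbour_essential:
  assumes "u \<in> V - A" "y \<in> V - A" "E u y"
    and "Suc (rem_mult (insert u (insert y A))) = rem_mult (insert u A)"
  shows "rem_mult (insert u A) = Suc (rem_mult A)"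
proof (rule ccontr)
  assume "\<not> ?thesis"
  then have le: "rem_mult (insert u A) \<le> rem_mult A"
    using rem_mult_insert_le[OF assms(1)] by linarith
  have "2 * rem_mult (insert u A) - 1 \<le> 2 * rem_mult (insert u (insert y A))"
    by (rule rem_mult_edge[OF assms(1-3)]) (use le rem_mult_le_insert[OF assms(2)] assms(4) in linarith)+
  then show False using assms(4) by linarith
qed

text \<open>Let k be \<open>rem_mult A\<close>. The edge bound with \<open>2 * k - 1\<close> rounds
  up to order at least k after deleting both vertices, and interlacing at \<open>z\<close> gives
  equality. A neutral \<open>u\<close> would then produce products of orders
  \<open>2 * k - 1\<close> and \<open>2 * k\<close>, against parity.\<close>

lemma rem_mult_special:
  assumes "u \<in> V - A" "z \<in> V - A" "E u z"
    and "Suc (rem_mult (insert z A)) = rem_mult A" "Suc (rem_mult (insert u A)) \<noteq> rem_mult A"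
  shows "rem_mult (insert u A) = Suc (rem_mult A)" "rem_mult (insert u (insert z A)) = rem_mult A"
proof -
  have ne: "u \<noteq> z" using assms(3) irrefl by blast
  have u: "rem_mult A \<le> rem_mult (insert u A)"
    using rem_mult_le_insert[OF assms(1)] assms(5) by linarith
  have "rem_mult (insert u A) \<le> Suc (rem_mult (insert u (insert z A)))"
    using rem_mult_le_insert[of z "insert u A"] assms(2) ne by (simp add: insert_commute)
  then have "2 * rem_mult A - 1 \<le> 2 * rem_mult (insert u (insert z A))"
    by (intro rem_mult_edge[OF assms(1-3)]) (use u assms(4) in linarith)+
  moreover have "rem_mult (insert u (insert z A)) \<le> Suc (rem_mult (insert z A))"
    using rem_mult_insert_le[of u "insert z A"] assms(1) ne by simp
  ultimately show uz: "rem_mult (insert u (insert z A)) = rem_mult A" using assms(4) by linarith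
  show "rem_mult (insert u A) = Suc (rem_mult A)"
  proof (rule ccontr)
    assume "\<not> ?thesis"
    then have eq: "rem_mult (insert u A) = rem_mult A"
      using rem_mult_insert_le[OF assms(1)] u by linarith
    have "rem_mult A = Suc (rem_mult (insert z A))" using assms(4) by simp
    then show False using rem_mult_parity[OF assms(1,2) ne] unfolding eq uz by simp
  qed
qed

section \<open>Essential vertices after deletion of a special vertex\<close>

lemma rem_mult_stability:
  assumes "u \<in> V" "z \<in> V" "v \<in> V" "v \<noteq> u" "E u z"
    and z: "Suc (rem_mult {z}) = rem_mult {}" and u: "Suc (rem_mult {u}) \<noteq> rem_mult {}"
  shows "Suc (rem_mult {u, v}) = rem_mult {u} \<longleftrightarrow> Suc (rem_mult {v}) = rem_mult {}"
proof -
  define k where "k = rem_mult {}"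
  have uz: "u \<noteq> z" using assms(5) irrefl by blast
  have up: "rem_mult A \<le> Suc (rem_mult (insert x A))" "rem_mult (insert x A) \<le> Suc (rem_mult A)"
    if "x \<in> V - A" for x A
    using that rem_mult_le_insert rem_mult_insert_le by blast+
  have k: "Suc (rem_mult {z}) = k" "rem_mult {u} = Suc k" "rem_mult {u, z} = k"
    using rem_mult_special[of u "{}" z] assms by (simp_all add: k_def)
  obtain l where l: "k = Suc l" "rem_mult {z} = l" using k(1) by metis
  show ?thesis
  proof
    \<comment> \<open>Interlacing alone suffices: \<open>u\<close> is positive, so the order at
      \<open>{u, v}\<close> is at least k, and it exceeds the order k - 1 at \<open>{v}\<close> by
      at most one.\<close>
    assume "Suc (rem_mult {v}) = rem_mult {}"
    then show "Suc (rem_mult {u, v}) = rem_mult {u}"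
      using up[of u "{v}"] up[of v "{u}"] k assms by (auto simp: k_def insert_commute)
  next
    assume "Suc (rem_mult {u, v}) = rem_mult {u}"
    then have uv: "rem_mult {u, v} = k" using k by simp
    show "Suc (rem_mult {v}) = rem_mult {}"
    proof (rule ccontr)
      assume "Suc (rem_mult {v}) \<noteq> rem_mult {}"
      then have v: "rem_mult {v} \<noteq> k - 1" "v \<noteq> z" and v_le: "k \<le> rem_mult {v}" "rem_mult {v} \<le> Suc k"
        using z up[of v "{}"] assms by (auto simp: k_def)
      have not_pos: "rem_mult {u, v} \<noteq> Suc (rem_mult {v})" using uv v_le by simp
      \<comment> \<open>If \<open>v\<close> were neutral, parity would make \<open>z\<close>
        essential in the graph without \<open>v\<close>. There \<open>u\<close> would be special,
        hence positive, which \<open>not_pos\<close> forbids.\<close>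
      have v_pos: "rem_mult {v} = Suc k"
      proof (rule ccontr)
        assume "rem_mult {v} \<noteq> Suc k"
        then have eq: "rem_mult {v} = k" using v_le by linarith
        have "rem_mult {v, z} \<noteq> k"
        proof
          assume "rem_mult {v, z} = k"
          then have "rem_mult {v} + rem_mult {z} = 2 * l + 1" "rem_mult {} + rem_mult {v, z} = 2 * l + 2"
            using eq l k_def by simp_all
          then show False using rem_mult_parity[of v "{}" z] assms(2,3) v(2) by simp
        qed
        then have "Suc (rem_mult {v, z}) = rem_mult {v}"
          using up[of z "{v}"] up[of v "{z}"] eq l assms(2,3) v(2) by (simp add: insert_commute)
        then show False
          using rem_mult_special[of u "{v}" z] assms uz v uv eq by (simp add: insert_commute)
      qed
      \<comment> \<open>Otherwise \<open>z\<close> would be essential once \<open>u\<close> and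
        \<open>v\<close> are deleted, which forces \<open>u\<close> to be positive in the graph
        without \<open>v\<close>.\<close>
      have uvz: "k \<le> rem_mult {u, v, z}"
      proof -
        have "k \<noteq> Suc (rem_mult {u, z, v})"
          using rem_mult_neighbour_essential[of u "{v}" z] assms uz v uv not_pos
          by (auto simp: insert_commute)
        then show ?thesis using up[of z "{u, v}"] assms uz v uv by (simp add: insert_commute)
      qed
      have vz: "rem_mult {v, z} = k"
        using up[of z "{v}"] up[of v "{z}"] v_pos k assms v by (auto simp: insert_commute)
      \<comment> \<open>The value k would give products of orders \<open>2 * l + 2\<close> and
        \<open>2 * l + 1\<close> for the pair \<open>u\<close>, \<open>v\<close> in the graph
        without \<open>z\<close>, against parity.\<close>
      have uvz_eq: "rem_mult {u, v, z} = Suc k"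
      proof (rule ccontr)
        assume "rem_mult {u, v, z} \<noteq> Suc k"
        then have eq: "rem_mult {u, v, z} = k"
          using up[of z "{u, v}"] uvz assms uz v uv by (simp add: insert_commute)
        have "rem_mult {u, z} + rem_mult {v, z} = 2 * l + 2" "rem_mult {z} + rem_mult {u, v, z} = 2 * l + 1"
          using k(3) vz eq l by simp_all
        then show False using rem_mult_parity[of u "{z}" v] assms(1,3,4) uz v(2) by simp
      qed
      \<comment> \<open>Deleting \<open>u\<close> from the graph without \<open>z\<close> raises the
        order from \<open>l\<close> to k, so expansion at \<open>u\<close> supplies the second
        neighbour \<open>y\<close>.\<close>
      have "\<exists>y\<in>V - {u, z}. E u y \<and> rem_mult {u, y, z} \<le> rem_mult {z}"
        by (rule ex_neighbour_rem_mult) (use assms(1) uz k l in auto)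
      then obtain y where y: "y \<in> V" "y \<noteq> u" "y \<noteq> z" "E u y" "rem_mult {u, y, z} \<le> l"
        using l(2) by blast
      have yv: "y \<noteq> v"
      proof
        assume "y = v"
        then show False using y(5) uvz_eq l(1) by simp
      qed
      have "rem_mult {u, y} \<le> Suc (rem_mult {u, y, z})"
        using up(1)[of z "{u, y}"] assms(2) uz y by (simp add: insert_commute)
      moreover have "rem_mult {u} \<le> Suc (rem_mult {u, y})"
        using up(1)[of y "{u}"] y by (simp add: insert_commute)
      ultimately have uy: "rem_mult {u, y} = k" and uyz: "rem_mult {u, y, z} = l"
        using k(2) l(1) y(5) by linarith+
      have "Suc (rem_mult {u, y, v}) \<noteq> k"
        using rem_mult_neighbour_essential[of u "{v}" y] assms(1,4) y(1,2,4) yv uv not_pos by auto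
      then have uvy: "k \<le> rem_mult {u, v, y}"
        using up(1)[of y "{u, v}"] y(1,2) yv uv by (simp add: insert_commute)
      have "rem_mult {u, v, z} \<le> Suc (rem_mult {u, v, y, z})"
        using up(1)[of y "{u, v, z}"] y(1-3) yv by (simp add: insert_commute)
      moreover have "rem_mult {u, v, y, z} \<le> Suc (rem_mult {u, y, z})"
        using up(2)[of v "{u, y, z}"] assms(3,4) yv v(2) by (simp add: insert_commute)
      ultimately have uvyz: "rem_mult {u, v, y, z} = k"
        using uvz_eq uyz l(1) by linarith
      \<comment> \<open>Without \<open>u\<close> the order is k + 1, it is k after deleting any one
        of \<open>y\<close>, \<open>z\<close>, \<open>v\<close>, and k - 1 after deleting
        \<open>y\<close> and \<open>z\<close>. It is k + 1 for \<open>z\<close>, \<open>v\<close>,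
        at least k for \<open>y\<close>, \<open>v\<close>, and k for all three. Hence the outer
        coefficients have order bound \<open>2 * k\<close>, while the dominant middle term has order
        \<open>2 * k - 1\<close>.\<close>
      have "2 * k \<le> rem_mult ({v} \<union> {u}) + rem_mult ({y, z} \<union> {u})"
        by (rule rem_mult_discriminant)
          (use assms(2-4) uz v(2) y(1-3) yv uv uy uyz uvy uvyz uvz_eq k(2,3) l(1) in \<open>simp_all add: insert_commute\<close>)
      then show False using uv uyz l(1) by (simp add: insert_commute)
    qed
  qed
qed

end

end

section \<open>Translation from essential and special vertices to orders of vanishing\<close>

theorem theorem5p11:
  fixes V :: "'a set" and E :: "'a \<Rightarrow> 'a \<Rightarrow> bool"
    and w :: "'a set \<Rightarrow> complex" and w1 :: "'a \<Rightarrow> real" and \<theta> :: real and u v :: 'a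
  assumes "finite V"
    and "\<forall>x y. E x y \<longrightarrow> E y x"
    and "\<forall>x. \<not> E x x"
    and "\<forall>x y. E x y \<longrightarrow> x \<in> V \<and> y \<in> V"
    and "\<forall>e\<in>edges V E. w e \<noteq> 0"
    and "special \<theta> V E w w1 u"
    and "v \<in> V - {u}"
  shows "essential \<theta> (V - {u}) E w w1 v \<longleftrightarrow> essential \<theta> V E w w1 v"
proof -
  have sym: "E x y \<Longrightarrow> E y x" and irrefl: "\<not> E x x" for x y
    using assms(2,3) by (iprover dest: spec)+
  have in_V: "x \<in> V" "y \<in> V" if "E x y" for x y
    using assms(4)[rule_format, OF that] by iprover+
  have weight: "w {x, y} \<noteq> 0" if "E x y" for x y
  proof (rule assms(5)[rule_format])
    show "{x, y} \<in> edges V E" using that in_V[OF that] by (auto simp: edges_def)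
  qed
  interpret weighted_graph E w
    by (rule weighted_graph.intro) (fact sym irrefl weight)+
  have ess: "essential \<theta> V E w w1 x \<longleftrightarrow>
      x \<in> V \<and> Suc (rem_mult V w1 \<theta> {x}) = rem_mult V w1 \<theta> {}" for x
    by (simp add: essential_def mult_w_def rem_mult_def[OF assms(1)]) linarith
  have ess_u: "essential \<theta> (V - {u}) E w w1 v \<longleftrightarrow>
      Suc (rem_mult V w1 \<theta> {u, v}) = rem_mult V w1 \<theta> {u}"
    using assms(7)
    by (simp add: essential_def mult_w_def rem_mult_def[OF assms(1)] Diff_insert2[symmetric]) linarith
  obtain z where z: "z \<in> V" "E u z" "essential \<theta> V E w w1 z" and u: "u \<in> V" "\<not> essential \<theta> V E w w1 u"
    using assms(6) unfolding special_def by (elim conjE bexE)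
  have "v \<in> V" "v \<noteq> u" using assms(7) by simp_all
  note stab = rem_mult_stability[OF assms(1) u(1) z(1) this z(2), of w1 \<theta>]
  show ?thesis
    unfolding ess_u ess[of v] using stab z(3) u \<open>v \<in> V\<close> unfolding ess by simp
qed

end
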